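(* Let $n=2$, let $K$ be a compact convex set in $\mathcal{K}$, set $k=\log([K])\in\mathcal{C}$ and suppose that $\deg(k^2)>0$. Let $L$ be any other compact convex set in $\mathcal{K}$ such that $\deg(\ell\cdot k)=0$, where $\ell=\log([L])\in\mathcal{C}$. Then $\deg(\ell^2)=0$.
   Context: $M$ is a lattice of rank $n$ (here $n=2$), $N=M^{\vee}$ its dual, $M_R=M\otimes_{\mathbb{Z}}R$, $N_R=N\otimes_{\mathbb{Z}}R$. Convex sets are non-empty. For a compact convex set $K\subset M_{\mathbb{R}}$ the support function is $h_K(v)=\inf_{m\in K}\langle m,v\rangle$ on $N_{\mathbb{R}}$; $K$ is rational if $h_K(N_{\mathbb{Q}})\subset\mathbb{Q}$. $\mathcal{K}$ is the set of rational compact convex sets in $M_{\mathbb{R}}$ together with $\emptyset$. The convex-set algebra $\mathcal{C}$ is the (commutative) $\mathbb{Q}$-algebra with a generator $[K]$ for every $K\in\mathcal{K}$, with $[\emptyset]=0$, subject to the relations: $[K_1\cup K_2]+[K_1\cap K_2]=[K_1]+[K_2]$ whenever $K_1\cup K_2\in\mathcal{K}$; $[K+t]=[K]$ for $t\in M_{\mathbb{Q}}$; $[K_1]\cdot[K_2]=[K_1+K_2]$ (Minkowski sum). Its unit is $1=[\{0\}]$; for non-empty $K\in\mathcal{K}$ one has $([K]-1)^{n+1}=0$ and $\log([K]):=\sum_{r=1}^n(-1)^{r+1}\frac1r([K]-1)^r$. $\mathcal{C}_{\ell}$ is the $\mathbb{Q}$-span of all $(\log[K])^{\ell}$; $\mathcal{C}=\bigoplus_{\ell=0}^n\mathcal{C}_{\ell}$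 is graded. $\deg\colon\mathcal{C}_n\to\mathbb{R}$ is the $\mathbb{Q}$-linear map with $\deg((\log[K])^n)=n!\,\mathrm{vol}(K)$ for all non-empty $K\in\mathcal{K}$ (this number is the degree $\mathbf{D}_K^n$ of the nef toric b-divisor corresponding to $K$), where $\mathrm{vol}$ is Lebesgue measure on $M_{\mathbb{R}}$ normalized so that $M$ has covolume $1$. *)

theory Defs
  imports "HOL-Analysis.Analysis" "HOL-Library.Poly_Mapping"
begin

section \<open>Rational compact convex sets\<close>

text \<open>
  A basis of the rank-\<open>n\<close> lattice \<open>M\<close> is fixed, so that \<open>M\<close> is the standard lattice in
  \<open>real ^ 'n\<close> with \<open>n = CARD('n)\<close>, its dual \<open>N\<close> is again the standard lattice, the pairing is
  the inner product, and Lebesgue measure gives \<open>M\<close> covolume 1.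
\<close>

definition rational_points :: "(real ^ 'n) set" where
  "rational_points = {v. \<forall>i. v $ i \<in> \<rat>}"

text \<open>The sign convention is that of toric geometry: an infimum, not a supremum.\<close>

definition support_fun :: "(real ^ 'n) set \<Rightarrow> real ^ 'n \<Rightarrow> real" where
  "support_fun K v = (INF m\<in>K. m \<bullet> v)"

definition rational_set :: "(real ^ 'n) set \<Rightarrow> bool" where
  "rational_set K \<longleftrightarrow> (\<forall>v\<in>rational_points. support_fun K v \<in> \<rat>)"

typedef ('n::finite) rat_convex =
  "{K :: (real ^ 'n) set. K = {} \<or> (compact K \<and> convex K \<and> rational_set K)}"
  morphisms carrier_of Abs_rat_convex
  by blast

section \<open>The convex-set algebra\<close>

text \<open>
  The free commutative \<open>\<rat>\<close>-algebra on the rational convex sets, i.e. the polynomial ring with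
  one variable for each of them: finitely supported rational combinations of monomials, a monomial
  being a finitely supported exponent function.
\<close>

type_synonym 'n free_alg = "('n rat_convex \<Rightarrow>\<^sub>0 nat) \<Rightarrow>\<^sub>0 rat"

definition gen :: "('n::finite) rat_convex \<Rightarrow> 'n free_alg" where
  "gen K = Poly_Mapping.single (Poly_Mapping.single K 1) 1"

text \<open>
  In the inclusion-exclusion relation the union is required to be rational convex; the
  intersection \<open>I\<close> is then automatically so. The last relation says that the class of \<open>{0}\<close>
  is the unit (multiplicativity alone would only make it a unit for the ideal spanned by the
  generators).
\<close>

inductive_set conv_relations :: "('n::finite) free_alg set" where
  empty: "carrier_of E = {} \<Longrightarrow> gen E \<in> conv_relations"
| inclusion_exclusion:
    "carrier_of U = carrier_of K1 \<union> carrier_of K2 \<Longrightarrow> carrier_of I = carrier_of K1 \<inter> carrier_of K2 \<Longrightarrow>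
     gen U + gen I - (gen K1 + gen K2) \<in> conv_relations"
| translation:
    "t \<in> rational_points \<Longrightarrow> carrier_of K' = (\<lambda>x. x + t) ` carrier_of K \<Longrightarrow>
     gen K' - gen K \<in> conv_relations"
| minkowski_sum:
    "carrier_of S = {x + y |x y. x \<in> carrier_of K1 \<and> y \<in> carrier_of K2} \<Longrightarrow>
     gen K1 * gen K2 - gen S \<in> conv_relations"
| unit: "carrier_of Z = {0} \<Longrightarrow> gen Z - 1 \<in> conv_relations"

text \<open>The ideal of a commutative ring generated by a set is its span over the ring itself.\<close>

global_interpretation ring_ideal: module "(*) :: 'a::comm_ring_1 \<Rightarrow> 'a \<Rightarrow> 'a"
  defines ring_ideal_span = ring_ideal.span
  by standard (simp_all add: algebra_simps)

definition conv_ideal :: "('n::finite) free_alg set" where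
  "conv_ideal = ring_ideal_span conv_relations"

lemma conv_ideal_zero: "0 \<in> conv_ideal"
  and conv_ideal_add: "p \<in> conv_ideal \<Longrightarrow> q \<in> conv_ideal \<Longrightarrow> p + q \<in> conv_ideal"
  and conv_ideal_diff: "p \<in> conv_ideal \<Longrightarrow> q \<in> conv_ideal \<Longrightarrow> p - q \<in> conv_ideal"
  and conv_ideal_neg: "p \<in> conv_ideal \<Longrightarrow> - p \<in> conv_ideal"
  and conv_ideal_mult: "p \<in> conv_ideal \<Longrightarrow> r * p \<in> conv_ideal"
  unfolding conv_ideal_def
  by (auto intro: ring_ideal.span_zero ring_ideal.span_add ring_ideal.span_diff
      ring_ideal.span_neg ring_ideal.span_scale)

quotient_type 'n conv_alg = "('n::finite) free_alg" / "\<lambda>p q. p - q \<in> conv_ideal"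
proof (rule equivpI)
  show "reflp (\<lambda>p q::'n free_alg. p - q \<in> conv_ideal)"
    by (simp add: reflp_def conv_ideal_zero)
  show "symp (\<lambda>p q::'n free_alg. p - q \<in> conv_ideal)"
    by (rule sympI, drule conv_ideal_neg, simp)
  show "transp (\<lambda>p q::'n free_alg. p - q \<in> conv_ideal)"
    by (rule transpI, drule (1) conv_ideal_add, simp)
qed

text \<open>
  The quotient is a non-zero ring: the Euler characteristic, sending every non-empty set to 1 and
  the empty set to 0, is a ring homomorphism to the rationals that respects the relations.
\<close>

definition nonempty_monom :: "(('n::finite) rat_convex \<Rightarrow>\<^sub>0 nat) \<Rightarrow> bool" where
  "nonempty_monom m \<longleftrightarrow> (\<forall>K\<in>Poly_Mapping.keys m. carrier_of K \<noteq> {})"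

definition euler_char :: "('n::finite) free_alg \<Rightarrow> rat" where
  "euler_char p = (\<Sum>m\<in>Poly_Mapping.keys p. if nonempty_monom m then Poly_Mapping.lookup p m else 0)"

lemma euler_char_eq:
  assumes "finite A" "Poly_Mapping.keys p \<subseteq> A"
  shows "euler_char p = (\<Sum>m\<in>A. if nonempty_monom m then Poly_Mapping.lookup p m else 0)"
  unfolding euler_char_def
  by (rule sum.mono_neutral_left) (use assms in \<open>auto simp: in_keys_iff\<close>)

lemma euler_char_add: "euler_char (p + q) = euler_char p + euler_char q"
proof -
  let ?A = "Poly_Mapping.keys p \<union> Poly_Mapping.keys q"
  have "euler_char (p + q) = (\<Sum>m\<in>?A. if nonempty_monom m then Poly_Mapping.lookup (p + q) m else 0)"
    by (rule euler_char_eq) (use Poly_Mapping.keys_add[of p q] in auto)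
  also have "\<dots> = (\<Sum>m\<in>?A. if nonempty_monom m then Poly_Mapping.lookup p m else 0) +
                  (\<Sum>m\<in>?A. if nonempty_monom m then Poly_Mapping.lookup q m else 0)"
    unfolding sum.distrib[symmetric] by (rule sum.cong) (auto simp: lookup_add)
  also have "\<dots> = euler_char p + euler_char q"
    by (simp add: euler_char_eq[of ?A p] euler_char_eq[of ?A q])
  finally show ?thesis .
qed

lemma euler_char_zero: "euler_char 0 = 0"
  by (simp add: euler_char_def)

lemma euler_char_diff: "euler_char (p - q) = euler_char p - euler_char q"
  using euler_char_add[of "p - q" q] by simp

lemma euler_char_single:
  "euler_char (Poly_Mapping.single m c) = (if nonempty_monom m then c else 0)"
  by (simp add: euler_char_def)

lemma nonempty_monom_add: "nonempty_monom (m + m') \<longleftrightarrow> nonempty_monom m \<and> nonempty_monom m'"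
proof -
  have "Poly_Mapping.keys (m + m') = Poly_Mapping.keys m \<union> Poly_Mapping.keys m'"
    by (auto simp: in_keys_iff lookup_add)
  then show ?thesis by (auto simp: nonempty_monom_def)
qed

lemma free_alg_induct:
  fixes p :: "'a \<Rightarrow>\<^sub>0 'b::monoid_add"
  assumes "P 0" "\<And>m c. P (Poly_Mapping.single m c)" "\<And>p q. P p \<Longrightarrow> P q \<Longrightarrow> P (p + q)"
  shows "P p"
proof (induction "card (Poly_Mapping.keys p)" arbitrary: p rule: less_induct)
  case less
  show ?case
  proof (cases "p = 0")
    case True
    then show ?thesis using assms(1) by simp
  next
    case False
    then obtain m where m: "m \<in> Poly_Mapping.keys p" by (auto simp flip: keys_eq_empty)
    define q where "q = Poly_Mapping.update m 0 p"
    have "Poly_Mapping.keys q = Poly_Mapping.keys p - {m}"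
      by (auto simp: q_def in_keys_iff lookup_update split: if_splits)
    then have "card (Poly_Mapping.keys q) < card (Poly_Mapping.keys p)"
      using m by (simp only: card_Diff1_less finite_keys)
    then have "P (q + Poly_Mapping.single m (Poly_Mapping.lookup p m))"
      by (intro assms(3) less assms(2))
    moreover have "q + Poly_Mapping.single m (Poly_Mapping.lookup p m) = p"
      by (rule poly_mapping_eqI)
        (auto simp: q_def lookup_add lookup_update lookup_single when_def)
    ultimately show ?thesis by (rule back_subst)
  qed
qed

lemma euler_char_mult: "euler_char (p * q) = euler_char p * euler_char q"
proof (induction p rule: free_alg_induct)
  case (2 m c)
  show ?case
  proof (induction q rule: free_alg_induct)
    case (2 m' c')
    show ?case
      by (simp add: mult_single euler_char_single nonempty_monom_add)
  qed (simp_all add: euler_char_zero euler_char_add algebra_simps)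
qed (simp_all add: euler_char_zero euler_char_add algebra_simps)

lemma euler_char_gen: "euler_char (gen K) = (if carrier_of K = {} then 0 else 1)"
  by (simp add: gen_def euler_char_single nonempty_monom_def)

lemma euler_char_one: "euler_char 1 = 1"
proof -
  have "(1 :: 'a free_alg) = Poly_Mapping.single 0 1" by simp
  then show ?thesis using euler_char_single[of 0 1] by (simp add: nonempty_monom_def)
qed

lemma carrier_of_properties:
  "carrier_of K = {} \<or> (compact (carrier_of K) \<and> convex (carrier_of K) \<and> rational_set (carrier_of K))"
  using carrier_of[of K] by simp

lemma euler_char_relation: "p \<in> conv_relations \<Longrightarrow> euler_char p = 0"
proof (induction rule: conv_relations.induct)
  case (inclusion_exclusion U K1 K2 I)
  have "carrier_of I \<noteq> {}" if "carrier_of K1 \<noteq> {}" "carrier_of K2 \<noteq> {}"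
  proof
    assume "carrier_of I = {}"
    then have "carrier_of K1 \<inter> carrier_of K2 = {}"
      using inclusion_exclusion by simp
    moreover have "connected (carrier_of K1 \<union> carrier_of K2)"
      using carrier_of_properties[of U] inclusion_exclusion by (auto intro: convex_connected)
    moreover have "closed (carrier_of K1)" "closed (carrier_of K2)"
      using carrier_of_properties[of K1] carrier_of_properties[of K2] by (auto intro: compact_imp_closed)
    ultimately show False
      using that unfolding connected_closed by blast
  qed
  with inclusion_exclusion show ?case
    by (auto simp: euler_char_add euler_char_diff euler_char_gen)
qed (auto simp: euler_char_add euler_char_diff euler_char_mult euler_char_gen euler_char_one)

lemma euler_char_ideal: "p \<in> conv_ideal \<Longrightarrow> euler_char p = 0"
  unfolding conv_ideal_def
  by (induction rule: ring_ideal.span_induct_alt)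
    (simp_all add: euler_char_zero euler_char_add euler_char_mult euler_char_relation)

instantiation conv_alg :: (finite) comm_ring_1
begin

lift_definition zero_conv_alg :: "'a conv_alg" is 0 .
lift_definition one_conv_alg :: "'a conv_alg" is 1 .
lift_definition plus_conv_alg :: "'a conv_alg \<Rightarrow> 'a conv_alg \<Rightarrow> 'a conv_alg" is "(+)"
  by (simp only: add_diff_add conv_ideal_add)
lift_definition minus_conv_alg :: "'a conv_alg \<Rightarrow> 'a conv_alg \<Rightarrow> 'a conv_alg" is "(-)"
  by (drule (1) conv_ideal_diff, simp add: algebra_simps)
lift_definition uminus_conv_alg :: "'a conv_alg \<Rightarrow> 'a conv_alg" is uminus
  by (drule conv_ideal_neg, simp)
lift_definition times_conv_alg :: "'a conv_alg \<Rightarrow> 'a conv_alg \<Rightarrow> 'a conv_alg" is "(*)"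
proof -
  fix p p' q q' :: "'a free_alg"
  assume "p - p' \<in> conv_ideal" "q - q' \<in> conv_ideal"
  then have "q * (p - p') + p' * (q - q') \<in> conv_ideal"
    by (intro conv_ideal_add conv_ideal_mult)
  then show "p * q - p' * q' \<in> conv_ideal"
    by (simp add: algebra_simps)
qed

instance
proof
  fix a b c :: "'a conv_alg"
  show "a + b + c = a + (b + c)"
    by transfer (simp only: add.assoc diff_self conv_ideal_zero)
  show "a + b = b + a"
    by transfer (simp only: add.commute diff_self conv_ideal_zero)
  show "0 + a = a"
    by transfer (simp only: add_0 diff_self conv_ideal_zero)
  show "- a + a = 0"
    by transfer (simp only: left_minus diff_self conv_ideal_zero)
  show "a - b = a + - b"
    by transfer (simp only: diff_conv_add_uminus[symmetric] diff_self conv_ideal_zero)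
  show "a * b * c = a * (b * c)"
    by transfer (simp only: mult.assoc diff_self conv_ideal_zero)
  show "a * b = b * a"
    by transfer (simp only: mult.commute diff_self conv_ideal_zero)
  show "1 * a = a"
    by transfer (simp only: mult_1 diff_self conv_ideal_zero)
  show "(a + b) * c = a * c + b * c"
    by transfer (simp only: distrib_right diff_self conv_ideal_zero)
  show "(0 :: 'a conv_alg) \<noteq> 1"
  proof transfer
    have "euler_char (0 - 1 :: 'a free_alg) = - 1"
      using euler_char_diff[of "0 :: 'a free_alg" 1]
      by (simp only: euler_char_zero euler_char_one diff_0)
    then show "(0 - 1 :: 'a free_alg) \<notin> conv_ideal"
      by (metis euler_char_ideal neg_equal_0_iff_equal zero_neq_one)
  qed
qed

end

lift_definition rat_scale :: "rat \<Rightarrow> ('n::finite) conv_alg \<Rightarrow> 'n conv_alg" (infixr \<open>*\<^sub>Q\<close> 75)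
  is "\<lambda>c p. Poly_Mapping.single 0 c * p"
  by (simp only: conv_ideal_mult flip: right_diff_distrib)

global_interpretation conv_alg: vector_space rat_scale
proof
  fix a b :: rat and x y :: "'a conv_alg"
  show "a *\<^sub>Q (x + y) = a *\<^sub>Q x + a *\<^sub>Q y"
    by transfer (simp add: distrib_left conv_ideal_zero)
  show "(a + b) *\<^sub>Q x = a *\<^sub>Q x + b *\<^sub>Q x"
    by transfer (simp add: single_add distrib_right conv_ideal_zero)
  show "a *\<^sub>Q b *\<^sub>Q x = (a * b) *\<^sub>Q x"
    by transfer (simp add: mult_single conv_ideal_zero flip: mult.assoc)
  show "1 *\<^sub>Q x = x"
    by transfer (simp add: conv_ideal_zero)
qed

lift_definition conv_class :: "('n::finite) rat_convex \<Rightarrow> 'n conv_alg" is gen .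

text \<open>Meant for non-empty \<open>K\<close> only.\<close>

definition conv_log :: "('n::finite) rat_convex \<Rightarrow> 'n conv_alg" where
  "conv_log K = (\<Sum>r = 1..CARD('n). ((- 1) ^ (r + 1) / of_nat r) *\<^sub>Q (conv_class K - 1) ^ r)"

definition conv_graded :: "nat \<Rightarrow> ('n::finite) conv_alg set" where
  "conv_graded l = conv_alg.span {conv_log K ^ l |K. carrier_of K \<noteq> {}}"

section \<open>The degree map\<close>

text \<open>
  The degree is a map on the top graded piece only, hence a partial map on the algebra, with
  domain exactly that piece: \<open>conv_deg x = Some a\<close> says that \<open>x\<close> lies in the top piece and has
  degree \<open>a\<close>. For polygons a product of \<open>n = 2\<close> logarithms always lies in the top piece; for
  convex sets with curved boundary this membership is a genuine condition, because nilpotency of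
  \<open>conv_class K - 1\<close> does not follow from the relations (affine arc length is a translation
  invariant valuation of degree \<open>2/3\<close>).
\<close>

definition is_degree_map :: "(('n::finite) conv_alg \<rightharpoonup> real) \<Rightarrow> bool" where
  "is_degree_map d \<longleftrightarrow>
     dom d = conv_graded CARD('n) \<and>
     (\<forall>x y a b. d x = Some a \<longrightarrow> d y = Some b \<longrightarrow> d (x + y) = Some (a + b)) \<and>
     (\<forall>q x a. d x = Some a \<longrightarrow> d (q *\<^sub>Q x) = Some (of_rat q * a)) \<and>
     (\<forall>K. carrier_of K \<noteq> {} \<longrightarrow>
        d (conv_log K ^ CARD('n)) = Some (fact CARD('n) * measure lebesgue (carrier_of K)))"

definition conv_deg :: "('n::finite) conv_alg \<rightharpoonup> real" where
  "conv_deg = (THE d. is_degree_map d)"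

end

theory Submission
  imports Defs
begin

text \<open>
  The volume is translation invariant, a valuation, and Minkowski addition of a fixed convex set
  preserves the inclusion-exclusion relation. Hence there is a \<open>\<rat>\<close>-linear functional on the whole
  convex-set algebra, \<open>volume_functional\<close>, that sends \<open>[K\<^sub>1] \<cdots> [K\<^sub>r]\<close> to the volume of
  \<open>K\<^sub>1 + \<dots> + K\<^sub>r\<close>. In the plane \<open>2 log [K] = 4 [K] - [K]\<^sup>2 - 3\<close>, so the functional sends
  \<open>(log [K])\<^sup>2\<close> to twice the area of \<open>K\<close>; therefore its restriction to the top graded piece is the
  degree (\<open>conv_deg_eq_volume_functional\<close>).
  
  The same identity turns \<open>deg (log [K] \<cdot> log [L])\<close> into
  \<open>5 vol (K + L) - vol (2 K + L) - vol (K + 2 L)\<close>, which is twice the mixed area of \<open>K\<close> and \<open>L\<close>.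
  The assumptions say that \<open>K\<close> has positive area and that this number vanishes; the conclusion is
  that \<open>L\<close> has area zero. So it is enough that the number is positive for two convex bodies of
  positive area. This is \<open>dilate_volume_mixed_area_pos\<close>, a consequence of the Brunn-Minkowski
  inequality in the plane.
  
  The Brunn-Minkowski inequality is proved by slicing. Let \<open>u\<close> and \<open>v\<close> be the functions that
  measure the vertical chords of \<open>A\<close> and \<open>B\<close>, with suprema \<open>M\<close> and \<open>N\<close>. If \<open>u x > t M\<close> and
  \<open>v y > t N\<close>, then \<open>A + B\<close> has above \<open>x + y\<close> a chord longer than \<open>t (M + N)\<close>. The superlevel sets
  are intervals, whose lengths add; integration over \<open>t\<close> in \<open>[0, 1)\<close> gives
  \<open>vol A / M + vol B / N \<le> vol (A + B) / (M + N)\<close>, and the inequality of square roots follows.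
\<close>

section \<open>The Brunn-Minkowski inequality in the plane\<close>

text \<open>
  For the ring acting on itself, this rule moves the parentheses in a product to the left, against
  \<open>mult.assoc\<close> in \<open>algebra_simps\<close>; the two together do not terminate.
\<close>

declare ring_ideal.scale_scale [simp del]

text \<open>
  The one-dimensional inequality. It is needed for superlevel sets, which need not be closed, so the
  lengths are compared through infima and suprema: \<open>I + J\<close> is an interval that comes arbitrarily close
  to both \<open>Inf I + Inf J\<close> and \<open>Sup I + Sup J\<close>.
\<close>

lemma emeasure_add_le_of_plus_subset:
  fixes I J C :: "real set"
  assumes I: "I \<noteq> {}" "bounded I" "convex I" and J: "J \<noteq> {}" "bounded J" "convex J"
    and C: "C \<in> sets borel" "I + J \<subseteq> C"
  shows "emeasure lborel I + emeasure lborel J \<le> emeasure lborel C"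
proof -
  note bdd = bounded_imp_bdd_above bounded_imp_bdd_below
  have le: "emeasure lborel S \<le> ennreal (Sup S - Inf S)" "Inf S \<le> Sup S"
    if "S \<noteq> {}" "bounded S" for S :: "real set"
  proof -
    show *: "Inf S \<le> Sup S"
      using that by (intro cInf_le_cSup bdd)
    have "S \<subseteq> {Inf S..Sup S}"
      using that by (auto intro!: cInf_lower cSup_upper bdd)
    then have "emeasure lborel S \<le> emeasure lborel {Inf S..Sup S}"
      by (intro emeasure_mono) auto
    then show "emeasure lborel S \<le> ennreal (Sup S - Inf S)"
      using * by simp
  qed
  have "{Inf I + Inf J <..< Sup I + Sup J} \<subseteq> I + J"
  proof
    fix z assume z: "z \<in> {Inf I + Inf J <..< Sup I + Sup J}"
    from z have "Inf I < z - Inf J" by simp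
    then obtain x where x: "x \<in> I" "x < z - Inf J"
      using cInf_lessD[OF I(1)] by blast
    then have "Inf J < z - x" by simp
    then obtain y where y: "y \<in> J" "y < z - x"
      using cInf_lessD[OF J(1)] by blast
    from z have "z - Sup J < Sup I" by simp
    then obtain x' where x': "x' \<in> I" "z - Sup J < x'"
      using less_cSupD[OF I(1)] by blast
    then have "z - x' < Sup J" by simp
    then obtain y' where y': "y' \<in> J" "z - x' < y'"
      using less_cSupD[OF J(1)] by blast
    have "is_interval (I + J)"
      using I J by (simp add: is_interval_convex_1 convex_set_plus)
    moreover have "x + y \<in> I + J" "x' + y' \<in> I + J" "x + y \<le> z" "z \<le> x' + y'"
      using x y x' y' by auto
    ultimately show "z \<in> I + J"
      unfolding is_interval_1 by blast
  qed
  then have "emeasure lborel {Inf I + Inf J <..< Sup I + Sup J} \<le> emeasure lborel C"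
    using C by (intro emeasure_mono) auto
  moreover have "emeasure lborel {Inf I + Inf J <..< Sup I + Sup J} =
      ennreal (Sup I - Inf I) + ennreal (Sup J - Inf J)"
    using le(2)[OF I(1,2)] le(2)[OF J(1,2)] by (simp add: algebra_simps flip: ennreal_plus)
  ultimately show ?thesis
    using add_mono[OF le(1)[OF I(1,2)] le(1)[OF J(1,2)]] by (metis order_trans)
qed

text \<open>
  The weighted version, for slices. As these are compact, it suffices that the combinations of the
  end points of \<open>I\<close> and \<open>J\<close> lie in \<open>C\<close>.
\<close>

lemma measure_combination_le:
  fixes I J C :: "real set"
  assumes I: "I \<noteq> {}" "compact I" "convex I" and J: "J \<noteq> {}" "compact J" "convex J"
    and C: "compact C" "convex C" and "a \<ge> 0" "b \<ge> 0"
    and IJC: "\<And>x y. x \<in> I \<Longrightarrow> y \<in> J \<Longrightarrow> a * x + b * y \<in> C"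
  shows "a * measure lborel I + b * measure lborel J \<le> measure lborel C"
proof -
  obtain p q where pq: "I = {p..q}"
    using I connected_compact_interval_1[of I] convex_connected by auto
  obtain r s where rs: "J = {r..s}"
    using J connected_compact_interval_1[of J] convex_connected by auto
  have le: "p \<le> q" "r \<le> s" using I J pq rs by auto
  have "a * p + b * r \<in> C" "a * q + b * s \<in> C"
    using IJC pq rs le by auto
  moreover have "is_interval C" using C by (simp add: is_interval_convex_1)
  ultimately have "{a * p + b * r..a * q + b * s} \<subseteq> C"
    unfolding is_interval_1 by (meson atLeastAtMost_iff subsetI)
  then have "measure lborel {a * p + b * r..a * q + b * s} \<le> measure lborel C"
    using fmeasurable_compact[OF C(1)] by (intro measure_mono_fmeasurable) auto
  moreover have "a * p + b * r \<le> a * q + b * s"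
    using le \<open>a \<ge> 0\<close> \<open>b \<ge> 0\<close> by (intro add_mono mult_left_mono)
  ultimately show ?thesis
    using le by (simp add: pq rs algebra_simps)
qed

definition chord_length :: "(real \<times> real) set \<Rightarrow> real \<Rightarrow> real" where
  "chord_length A x = measure lborel (Pair x -` A)"

lemma compact_slice:
  fixes A :: "(real \<times> real) set"
  assumes "compact A" shows "compact (Pair x -` A)"
proof -
  have "Pair x -` A = snd ` (A \<inter> ({x} \<times> UNIV))" by force
  moreover have "compact (A \<inter> ({x} \<times> UNIV))"
    using assms by (intro compact_Int_closed closed_Times) auto
  ultimately show ?thesis
    by (auto intro!: compact_continuous_image continuous_intros)
qed

lemma convex_slice:
  fixes A :: "(real \<times> real) set"
  assumes "convex A" shows "convex (Pair x -` A)"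
proof (rule convexI)
  fix y z u v :: real
  assume "y \<in> Pair x -` A" "z \<in> Pair x -` A" "0 \<le> u" "0 \<le> v" "u + v = 1"
  then have "u *\<^sub>R (x, y) + v *\<^sub>R (x, z) \<in> A"
    using assms by (intro convexD) auto
  moreover have "u *\<^sub>R (x, y) + v *\<^sub>R (x, z) = (x, u *\<^sub>R y + v *\<^sub>R z)"
    using \<open>u + v = 1\<close> by (simp flip: distrib_right)
  ultimately show "u *\<^sub>R y + v *\<^sub>R z \<in> Pair x -` A" by simp
qed

text \<open>
  With \<open>a = b = 1\<close> this bounds the chords of a Minkowski sum from below, with \<open>a + b = 1\<close> and
  \<open>A = B = C\<close> it is concavity of the chord length. Both fail over points where a chord is empty,
  whence the positivity assumptions.
\<close>

lemma chord_length_combination: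
  assumes A: "compact A" "convex A" "chord_length A x > 0"
    and B: "compact B" "convex B" "chord_length B y > 0"
    and C: "compact C" "convex C" and "a \<ge> 0" "b \<ge> 0"
    and ABC: "\<And>p q. p \<in> A \<Longrightarrow> q \<in> B \<Longrightarrow> a *\<^sub>R p + b *\<^sub>R q \<in> C"
  shows "a * chord_length A x + b * chord_length B y \<le> chord_length C (a * x + b * y)"
  unfolding chord_length_def
proof (rule measure_combination_le)
  show "Pair x -` A \<noteq> {}" "Pair y -` B \<noteq> {}"
    using A(3) B(3) by (auto simp: chord_length_def)
  fix s t assume "s \<in> Pair x -` A" "t \<in> Pair y -` B"
  then show "a * s + b * t \<in> Pair (a * x + b * y) -` C"
    using ABC[of "(x, s)" "(y, t)"] by simp
qed (use assms in \<open>simp_all add: compact_slice convex_slice\<close>)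

lemma chord_superlevel:
  assumes "compact A" "convex A" "s \<ge> 0"
  shows "convex {x. s < chord_length A x}" "bounded {x. s < chord_length A x}"
proof -
  show "convex {x. s < chord_length A x}"
  proof (rule convexI)
    fix x y a b :: real
    assume *: "x \<in> {x. s < chord_length A x}" "y \<in> {x. s < chord_length A x}"
      and ab: "0 \<le> a" "0 \<le> b" "a + b = 1"
    have "s = a * s + b * s" using ab by (simp flip: distrib_right)
    also have "\<dots> < a * chord_length A x + b * chord_length A y"
    proof (cases "a = 0")
      case False
      with * ab show ?thesis
        by (intro add_less_le_mono mult_strict_left_mono mult_left_mono) auto
    qed (use * ab in auto)
    also have "\<dots> \<le> chord_length A (a * x + b * y)"
      using assms * ab by (intro chord_length_combination) (auto intro: convexD)
    finally show "a *\<^sub>R x + b *\<^sub>R y \<in> {x. s < chord_length A x}" by simp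
  qed
  have "{x. s < chord_length A x} \<subseteq> fst ` A"
  proof
    fix x assume "x \<in> {x. s < chord_length A x}"
    then have "Pair x -` A \<noteq> {}" using assms(3) by (auto simp: chord_length_def)
    then show "x \<in> fst ` A" by force
  qed
  then show "bounded {x. s < chord_length A x}"
    using assms(1) by (meson bounded_fst bounded_subset compact_imp_bounded)
qed

lemma borel_measurable_chord_length:
  assumes "compact A" shows "chord_length A \<in> borel_measurable borel"
proof -
  have "A \<in> sets (borel \<Otimes>\<^sub>M borel)"
    using assms by (subst borel_prod) (rule borel_compact)
  then have "A \<in> sets (borel \<Otimes>\<^sub>M lborel)"
    by (metis sets_lborel sets_pair_measure_cong)
  then have "(\<lambda>x. emeasure lborel (Pair x -` A)) \<in> borel_measurable borel"
    by (rule lborel.measurable_emeasure_Pair)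
  then show ?thesis
    unfolding chord_length_def[abs_def] measure_def by measurable
qed

lemma nn_integral_chord_length:
  assumes "compact A"
  shows "(\<integral>\<^sup>+x. ennreal (chord_length A x) \<partial>lborel) = ennreal (measure lborel A)"
proof -
  have "emeasure lborel A = emeasure (lborel \<Otimes>\<^sub>M lborel) A"
    by (simp add: lborel_prod)
  also have "\<dots> = (\<integral>\<^sup>+x. emeasure lborel (Pair x -` A) \<partial>lborel)"
    using assms by (intro lborel.emeasure_pair_measure_alt) (auto simp only: lborel_prod sets_lborel intro: borel_compact)
  also have "\<dots> = (\<integral>\<^sup>+x. ennreal (chord_length A x) \<partial>lborel)"
    unfolding chord_length_def
    using emeasure_compact_finite[OF compact_slice[OF assms]]
    by (intro nn_integral_cong emeasure_eq_ennreal_measure) (auto simp: less_top)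
  also have "emeasure lborel A = ennreal (measure lborel A)"
    using emeasure_compact_finite[OF assms] by (intro emeasure_eq_ennreal_measure) auto
  finally show ?thesis by simp
qed

lemma borel_measurable_superlevel:
  fixes u :: "real \<Rightarrow> real"
  assumes [measurable]: "u \<in> borel_measurable borel"
  shows "(\<lambda>t. emeasure lborel {x. t * M < u x}) \<in> borel_measurable lborel"
proof -
  have "{p \<in> space (lborel \<Otimes>\<^sub>M lborel). fst p * M < u (snd p)} \<in> sets (lborel \<Otimes>\<^sub>M lborel)"
    by measurable
  from lborel.measurable_emeasure_Pair[OF this] show ?thesis
    by (simp add: space_pair_measure vimage_def)
qed

text \<open>
  The layer-cake formula, truncated at height \<open>M\<close>: both sides are the area of the part of the region
  below the graph of \<open>u / M\<close> that has height less than \<open>1\<close>.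
\<close>

lemma nn_integral_superlevels:
  fixes u :: "real \<Rightarrow> real"
  assumes [measurable]: "u \<in> borel_measurable borel" and u: "\<And>x. u x \<ge> 0" and "M > 0"
  shows "(\<integral>\<^sup>+t. emeasure lborel {x. t * M < u x} * indicator {0..<1} t \<partial>lborel)
       = (\<integral>\<^sup>+x. ennreal (min 1 (u x / M)) \<partial>lborel)"
proof -
  define E where "E = {(x, t). 0 \<le> t \<and> t < 1 \<and> t * M < u x}"
  have "{p \<in> space (lborel \<Otimes>\<^sub>M lborel). 0 \<le> snd p \<and> snd p < 1 \<and> snd p * M < u (fst p)}
      \<in> sets (lborel \<Otimes>\<^sub>M lborel)"
    by measurable
  then have [measurable]: "E \<in> sets (lborel \<Otimes>\<^sub>M lborel)"
    by (simp add: E_def space_pair_measure case_prod_unfold)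
  have "(\<integral>\<^sup>+t. emeasure lborel {x. t * M < u x} * indicator {0..<1} t \<partial>lborel)
      = (\<integral>\<^sup>+t. emeasure lborel ((\<lambda>x. (x, t)) -` E) \<partial>lborel)"
    by (intro nn_integral_cong) (auto simp: E_def indicator_def)
  also have "\<dots> = emeasure (lborel \<Otimes>\<^sub>M lborel) E"
    by (rule lborel_pair.emeasure_pair_measure_alt2[symmetric]) measurable
  also have "\<dots> = (\<integral>\<^sup>+x. emeasure lborel (Pair x -` E) \<partial>lborel)"
    by (rule lborel.emeasure_pair_measure_alt) measurable
  also have "\<dots> = (\<integral>\<^sup>+x. ennreal (min 1 (u x / M)) \<partial>lborel)"
  proof (intro nn_integral_cong)
    fix x
    have "Pair x -` E = {0..<min 1 (u x / M)}"
      using \<open>M > 0\<close> by (auto simp: E_def field_simps)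
    then show "emeasure lborel (Pair x -` E) = ennreal (min 1 (u x / M))"
      using u[of x] \<open>M > 0\<close> by simp
  qed
  finally show ?thesis .
qed

text \<open>
  Chords longer than \<open>M\<close> are cut off by the truncation, so in general there is only an inequality.
  For a Minkowski sum it has the direction that is needed; the longest chord of a sum
  may well exceed the sum of the longest chords.
\<close>

lemma nn_integral_superlevels_chord_length:
  assumes A: "compact A" and "M > 0"
  shows "(\<integral>\<^sup>+t. emeasure lborel {x. t * M < chord_length A x} * indicator {0..<1} t \<partial>lborel)
      \<le> ennreal (measure lborel A / M)"
    and "(\<And>x. chord_length A x \<le> M) \<Longrightarrow>
      (\<integral>\<^sup>+t. emeasure lborel {x. t * M < chord_length A x} * indicator {0..<1} t \<partial>lborel)
      = ennreal (measure lborel A / M)"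
proof -
  note [measurable] = borel_measurable_chord_length[OF A]
  have nonneg: "chord_length A x \<ge> 0" for x by (simp add: chord_length_def)
  note * = nn_integral_superlevels[OF borel_measurable_chord_length[OF A] nonneg \<open>M > 0\<close>]
  have "(\<integral>\<^sup>+x. ennreal (chord_length A x / M) \<partial>lborel) =
      (\<integral>\<^sup>+x. ennreal (1 / M) * ennreal (chord_length A x) \<partial>lborel)"
    using \<open>M > 0\<close> nonneg by (intro nn_integral_cong) (simp flip: ennreal_mult)
  also have "\<dots> = ennreal (1 / M) * ennreal (measure lborel A)"
    by (simp add: nn_integral_cmult nn_integral_chord_length[OF A])
  also have "\<dots> = ennreal (measure lborel A / M)"
    using \<open>M > 0\<close> by (simp flip: ennreal_mult)
  finally have **: "(\<integral>\<^sup>+x. ennreal (chord_length A x / M) \<partial>lborel) = ennreal (measure lborel A / M)" .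
  show "(\<integral>\<^sup>+t. emeasure lborel {x. t * M < chord_length A x} * indicator {0..<1} t \<partial>lborel)
      \<le> ennreal (measure lborel A / M)"
    unfolding * **[symmetric] by (intro nn_integral_mono ennreal_leI) simp
  assume "\<And>x. chord_length A x \<le> M"
  then have "min 1 (chord_length A x / M) = chord_length A x / M" for x
    using \<open>M > 0\<close> by (simp add: min_absorb2)
  then show "(\<integral>\<^sup>+t. emeasure lborel {x. t * M < chord_length A x} * indicator {0..<1} t \<partial>lborel)
      = ennreal (measure lborel A / M)"
    unfolding * **[symmetric] by simp
qed

lemma chord_length_Sup:
  assumes "compact A" "measure lborel A > 0"
  shows "bdd_above (range (chord_length A))" "Sup (range (chord_length A)) > 0"
proof -
  obtain a where a: "\<And>p. p \<in> A \<Longrightarrow> norm p \<le> a" 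
    using compact_imp_bounded[OF assms(1)] by (auto simp: bounded_iff)
  have "chord_length A x \<le> measure lborel (cball (0::real) a)" for x
    unfolding chord_length_def
  proof (rule measure_mono_fmeasurable)
    show "Pair x -` A \<subseteq> cball 0 a"
    proof
      fix y assume "y \<in> Pair x -` A"
      then have "norm (x, y) \<le> a" using a by auto
      then show "y \<in> cball 0 a" using norm_snd_le[of y x] by simp
    qed
  qed (use compact_slice[OF assms(1)] in \<open>auto intro: borel_compact fmeasurable_compact\<close>)
  then show bdd: "bdd_above (range (chord_length A))" by (rule bdd_aboveI2)
  have "\<exists>x. chord_length A x > 0"
  proof (rule ccontr)
    assume "\<not> ?thesis"
    then have "chord_length A x = 0" for x
      by (simp add: chord_length_def not_less measure_le_0_iff)
    then show False
      using nn_integral_chord_length[OF assms(1)] assms(2) by (simp add: ennreal_eq_0_iff)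
  qed
  then obtain x where "chord_length A x > 0" by blast
  then show "Sup (range (chord_length A)) > 0"
    using cSUP_upper[OF UNIV_I bdd, of x] by linarith
qed

text \<open>
  Integration over the levels gives \<open>\<alpha> / M + \<beta> / N \<le> \<gamma> / (M + N)\<close>. Multiplied out, the left-hand
  side exceeds \<open>(sqrt \<alpha> + sqrt \<beta>)\<^sup>2\<close> by a square divided by \<open>M N\<close>.
\<close>

theorem brunn_minkowski_real_pair:
  fixes A B C :: "(real \<times> real) set"
  assumes A: "compact A" "convex A" "measure lborel A > 0"
    and B: "compact B" "convex B" "measure lborel B > 0"
    and C: "compact C" "convex C" "A + B \<subseteq> C"
  shows "sqrt (measure lborel A) + sqrt (measure lborel B) \<le> sqrt (measure lborel C)"
proof -
  define M N where "M = Sup (range (chord_length A))" and "N = Sup (range (chord_length B))"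
  define \<alpha> \<beta> \<gamma> where "\<alpha> = measure lborel A" and "\<beta> = measure lborel B" and "\<gamma> = measure lborel C"
  have MN: "M > 0" "N > 0"
    using chord_length_Sup A B by (auto simp: M_def N_def)
  have leM: "chord_length A x \<le> M" and leN: "chord_length B x \<le> N" for x
    unfolding M_def N_def using A B by (simp_all add: cSUP_upper chord_length_Sup)
  note [measurable] = A(1)[THEN borel_measurable_chord_length] B(1)[THEN borel_measurable_chord_length]
    C(1)[THEN borel_measurable_chord_length]
  \<comment> \<open>\<open>t < 1\<close> makes both superlevel sets on the left non-empty, whether or not the suprema are attained.\<close>
  have level: "emeasure lborel {x. t * M < chord_length A x} + emeasure lborel {x. t * N < chord_length B x}
      \<le> emeasure lborel {x. t * (M + N) < chord_length C x}" if t: "0 \<le> t" "t < 1" for t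
  proof (rule emeasure_add_le_of_plus_subset)
    have "t * M < M" "t * N < N" using t MN by auto
    then show "{x. t * M < chord_length A x} \<noteq> {}" "{x. t * N < chord_length B x} \<noteq> {}"
      unfolding M_def N_def
      using A B by (auto simp: less_cSUP_iff chord_length_Sup)
    show "{x. t * M < chord_length A x} + {x. t * N < chord_length B x}
        \<subseteq> {x. t * (M + N) < chord_length C x}"
    proof (clarsimp elim!: set_plus_elim)
      fix x y assume xy: "t * M < chord_length A x" "t * N < chord_length B y"
      moreover have "t * M \<ge> 0" "t * N \<ge> 0" using t MN by auto
      ultimately have "1 * chord_length A x + 1 * chord_length B y \<le> chord_length C (1 * x + 1 * y)"
        using A B C by (intro chord_length_combination) (auto dest: set_plus_intro)
      then show "t * (M + N) < chord_length C (x + y)"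
        using xy by (simp add: algebra_simps)
    qed
    show "{x. t * (M + N) < chord_length C x} \<in> sets borel" by measurable
  qed (use t MN A B in \<open>simp_all add: chord_superlevel\<close>)
  have "ennreal (\<alpha> / M + \<beta> / N) = ennreal (\<alpha> / M) + ennreal (\<beta> / N)"
    using MN A B by (simp add: \<alpha>_def \<beta>_def)
  also have "\<dots> = (\<integral>\<^sup>+t. emeasure lborel {x. t * M < chord_length A x} * indicator {0..<1} t \<partial>lborel) +
      (\<integral>\<^sup>+t. emeasure lborel {x. t * N < chord_length B x} * indicator {0..<1} t \<partial>lborel)"
    using A B MN leM leN by (simp add: nn_integral_superlevels_chord_length \<alpha>_def \<beta>_def)
  also have "\<dots> = (\<integral>\<^sup>+t. emeasure lborel {x. t * M < chord_length A x} * indicator {0..<1} t +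
      emeasure lborel {x. t * N < chord_length B x} * indicator {0..<1} t \<partial>lborel)"
    by (intro nn_integral_add[symmetric] borel_measurable_times_ennreal borel_measurable_superlevel
        borel_measurable_chord_length A B borel_measurable_indicator) auto
  also have "\<dots> \<le> (\<integral>\<^sup>+t. emeasure lborel {x. t * (M + N) < chord_length C x} * indicator {0..<1} t \<partial>lborel)"
    using level by (intro nn_integral_mono) (auto simp: indicator_def)
  also have "\<dots> \<le> ennreal (\<gamma> / (M + N))"
    unfolding \<gamma>_def using C MN by (intro nn_integral_superlevels_chord_length) auto
  finally have "\<alpha> / M + \<beta> / N \<le> \<gamma> / (M + N)"
    using MN by (subst (asm) ennreal_le_iff) (auto simp: \<gamma>_def)
  moreover have "M + N > 0" using MN by simp
  ultimately have "(M + N) * (\<alpha> / M + \<beta> / N) \<le> \<gamma>"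
    by (subst mult.commute) (rule pos_le_divide_eq[THEN iffD1])
  moreover have "(M + N) * (\<alpha> / M + \<beta> / N) - (sqrt \<alpha> + sqrt \<beta>)\<^sup>2 =
      (N * sqrt \<alpha> - M * sqrt \<beta>)\<^sup>2 / (M * N)"
  proof -
    have "\<alpha> = (sqrt \<alpha>)\<^sup>2" "\<beta> = (sqrt \<beta>)\<^sup>2" by (auto simp: \<alpha>_def \<beta>_def)
    then obtain a b where ab: "\<alpha> = a\<^sup>2" "\<beta> = b\<^sup>2" "sqrt \<alpha> = a" "sqrt \<beta> = b" by blast
    show ?thesis unfolding ab(3,4) unfolding ab using MN
      by (simp add: field_simps power2_eq_square)
  qed
  moreover have "(N * sqrt \<alpha> - M * sqrt \<beta>)\<^sup>2 / (M * N) \<ge> 0"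
    using MN by simp
  ultimately have "(sqrt \<alpha> + sqrt \<beta>)\<^sup>2 \<le> \<gamma>" by linarith
  then show ?thesis
    unfolding \<alpha>_def \<beta>_def \<gamma>_def by (rule real_le_rsqrt)
qed

text \<open>
  The areas in \<open>real \<times> real\<close>, where Fubini's theorem applies directly, are now transported to
  \<open>real ^ 2\<close>.
\<close>

lemma compact_set_plus:
  fixes A B :: "'a::real_normed_vector set"
  assumes "compact A" "compact B"
  shows "compact (A + B)"
proof -
  have "A + B = {x + y |x y. x \<in> A \<and> y \<in> B}"
    by (auto simp: set_plus_def)
  then show ?thesis using compact_sums[OF assms] by simp
qed

lemma borel_measurable_vector_2:
  "(\<lambda>(x, y). vector [x, y] :: real ^ 2) \<in> borel_measurable borel"
proof (rule borel_measurable_continuous_onI)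
  have "(\<lambda>(x, y). vector [x, y] :: real ^ 2) = (\<lambda>p. \<chi> i. if i = 1 then fst p else snd p)"
    by (auto simp: fun_eq_iff vec_eq_iff forall_2)
  moreover have "continuous_on UNIV (\<lambda>p. (\<chi> i. if i = 1 then fst p else snd p) :: real ^ 2)"
  proof (rule continuous_on_vec_lambda)
    show "continuous_on UNIV (\<lambda>p. if i = 1 then fst p else snd p :: real)" for i :: 2
      by (cases "i = 1") (auto intro: continuous_intros)
  qed
  ultimately show "continuous_on UNIV (\<lambda>(x, y). vector [x, y] :: real ^ 2)" by simp
qed

lemma lborel_real_2_eq_distr:
  "distr lborel borel (\<lambda>(x, y). vector [x, y] :: real ^ 2) = lborel"
proof (rule lborel_eqI[symmetric])
  let ?f = "\<lambda>(x, y). vector [x, y] :: real ^ 2"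
  note [measurable] = borel_measurable_vector_2
  show "sets (distr lborel borel ?f) = sets borel" by simp
  fix l u :: "real ^ 2"
  assume le: "\<And>b. b \<in> Basis \<Longrightarrow> l \<bullet> b \<le> u \<bullet> b"
  have le': "l $ i \<le> u $ i" for i
    using le[of "axis i 1"] by (simp add: inner_axis axis_in_Basis_iff)
  have "?f -` box l u = {l $ 1<..<u $ 1} \<times> {l $ 2<..<u $ 2}"
    by (auto simp: mem_box_cart forall_2)
  then have "emeasure (distr lborel borel ?f) (box l u) =
      emeasure (lborel \<Otimes>\<^sub>M lborel) ({l $ 1<..<u $ 1} \<times> {l $ 2<..<u $ 2})"
    by (subst emeasure_distr) (auto simp: lborel_prod)
  also have "\<dots> = ennreal ((u $ 1 - l $ 1) * (u $ 2 - l $ 2))"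
    using le' by (subst lborel.emeasure_pair_measure_Times) (auto simp: ennreal_mult)
  also have "(u $ 1 - l $ 1) * (u $ 2 - l $ 2) = (\<Prod>i\<in>UNIV. (u - l) $ i)"
    by (simp add: UNIV_2)
  also have "\<dots> = (\<Prod>b\<in>(\<lambda>i. axis i 1) ` UNIV. (u - l) \<bullet> b)"
    by (subst prod.reindex) (auto simp: inj_on_def axis_eq_axis inner_axis)
  also have "(\<lambda>i. axis i 1) ` UNIV = (Basis :: (real ^ 2) set)"
    by (auto simp: Basis_vec_def)
  finally show "emeasure (distr lborel borel ?f) (box l u) = (\<Prod>b\<in>Basis. (u - l) \<bullet> b)" .
qed

theorem brunn_minkowski_plane:
  fixes A B :: "(real ^ 2) set"
  assumes A: "compact A" "convex A" "measure lebesgue A > 0"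
    and B: "compact B" "convex B" "measure lebesgue B > 0"
  shows "sqrt (measure lebesgue A) + sqrt (measure lebesgue B) \<le> sqrt (measure lebesgue (A + B))"
proof -
  define f where "f = (\<lambda>(x, y). vector [x, y] :: real ^ 2)"
  define g where "g = (\<lambda>v :: real ^ 2. (v $ 1, v $ 2))"
  have fg: "f (g v) = v" and gf: "g (f p) = p" for v p
    by (auto simp: f_def g_def vec_eq_iff forall_2 split: prod.splits)
  have lin: "linear g"
    by (rule linearI) (auto simp: g_def)
  have [measurable]: "f \<in> measurable lborel borel"
    using borel_measurable_vector_2 by (simp add: f_def)
  have vim: "f -` S = g ` S" for S
    using fg gf by (auto simp: image_iff) metis
  have meas: "measure lborel (f -` S) = measure lebesgue S" if "compact S" for S
  proof -
    have "measure lebesgue S = measure (distr lborel borel f) S"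
      using that by (simp add: measure_completion borel_compact lborel_real_2_eq_distr f_def)
    also have "\<dots> = measure lborel (f -` S)"
      using that by (subst measure_distr) (auto intro: borel_compact)
    finally show ?thesis by simp
  qed
  have cc: "compact (f -` S)" "convex (f -` S)" if "compact S" "convex S" for S
    unfolding vim using that lin
    by (auto intro: compact_continuous_image linear_continuous_on convex_linear_image simp: linear_conv_bounded_linear)
  have AB: "compact (A + B)" "convex (A + B)"
    using A B by (auto intro: compact_set_plus convex_set_plus)
  have "sqrt (measure lborel (f -` A)) + sqrt (measure lborel (f -` B)) \<le> sqrt (measure lborel (f -` (A + B)))"
  proof (rule brunn_minkowski_real_pair)
    show "f -` A + f -` B \<subseteq> f -` (A + B)"
      unfolding vim using lin by (auto elim!: set_plus_elim simp flip: linear_add)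
  qed (use A B AB cc meas in auto)
  then show ?thesis using A B AB by (simp add: meas)
qed

section \<open>Areas of integral combinations of two convex sets\<close>

lemma sum_const_lessThan_add:
  fixes a :: "'a::comm_monoid_add" and m n :: nat
  shows "(\<Sum>i<m + n. a) = (\<Sum>i<m. a) + (\<Sum>i<n. a)"
  by (induction n) (auto simp: ac_simps)

lemma sum_const_lessThan_mult:
  fixes a :: "'a::comm_monoid_add" and m n :: nat
  shows "(\<Sum>i<m * n. a) = (\<Sum>j<m. \<Sum>i<n. a)"
  by (induction m) (simp_all add: sum_const_lessThan_add add.commute)

lemma compact_sum_set:
  fixes f :: "'b \<Rightarrow> ('a::real_normed_vector) set"
  assumes "\<And>i. i \<in> I \<Longrightarrow> compact (f i)"
  shows "compact (sum f I)"
  using assms by (induction I rule: infinite_finite_induct) (auto intro: compact_set_plus)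

lemma sum_set_nonempty:
  fixes f :: "'b \<Rightarrow> ('a::comm_monoid_add) set"
  assumes "\<And>i. i \<in> I \<Longrightarrow> f i \<noteq> {}"
  shows "sum f I \<noteq> {}"
  using assms
proof (induction I rule: infinite_finite_induct)
  case (insert x F)
  then obtain u v where "u \<in> f x" "v \<in> sum f F" by blast
  then have "u + v \<in> sum f (insert x F)"
    using insert.hyps by (simp add: set_plus_intro)
  then show ?case by blast
qed auto

text \<open>
  Convexity gives \<open>n A + A \<subseteq> (n + 1) A\<close>: the point \<open>n x + y\<close> is \<open>n + 1\<close> times the weighted mean of
  \<open>x\<close> and \<open>y\<close>.
\<close>

lemma sum_convex_set_eq_scaleR:
  fixes A :: "'a::real_vector set"
  assumes "convex A" "A \<noteq> {}"
  shows "(\<Sum>i<n. A) = (\<lambda>x. real n *\<^sub>R x) ` A"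
proof (induction n)
  case 0
  then show ?case using assms by auto
next
  case (Suc n)
  have "(\<lambda>x. real n *\<^sub>R x) ` A + A = (\<lambda>x. real (Suc n) *\<^sub>R x) ` A"
  proof
    show "(\<lambda>x. real n *\<^sub>R x) ` A + A \<subseteq> (\<lambda>x. real (Suc n) *\<^sub>R x) ` A"
    proof
      fix z assume "z \<in> (\<lambda>x. real n *\<^sub>R x) ` A + A"
      then obtain x y where xy: "x \<in> A" "y \<in> A" and z: "z = real n *\<^sub>R x + y"
        unfolding set_plus_def by blast
      define w where "w = (real n / real (Suc n)) *\<^sub>R x + (1 / real (Suc n)) *\<^sub>R y"
      have "w \<in> A"
        unfolding w_def using xy assms(1)
        by (intro convexD) (auto simp: field_simps)
      moreover have "z = real (Suc n) *\<^sub>R w"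
        by (simp add: w_def z scaleR_add_right del: of_nat_Suc)
      ultimately show "z \<in> (\<lambda>x. real (Suc n) *\<^sub>R x) ` A" by blast
    qed
    show "(\<lambda>x. real (Suc n) *\<^sub>R x) ` A \<subseteq> (\<lambda>x. real n *\<^sub>R x) ` A + A"
      by (auto simp: scaleR_add_left add.commute[of 1])
  qed
  with Suc show ?case by (simp add: add.commute)
qed

text \<open>
  The volume of \<open>a A + b B\<close> for convex \<open>A\<close> and \<open>B\<close>. The dilates are written as iterated Minkowski
  sums, since this is how they arise from powers of generators of the convex-set algebra, and since
  additivity in \<open>(a, b)\<close> is then a formal matter.
\<close>

definition dilate_volume :: "(real ^ 'n::finite) set \<Rightarrow> (real ^ 'n) set \<Rightarrow> nat \<Rightarrow> nat \<Rightarrow> real" where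
  "dilate_volume A B a b = measure lebesgue ((\<Sum>i<a. A) + (\<Sum>i<b. B))"

lemma dilate_volume_scale:
  fixes A B :: "(real ^ 'n::finite) set"
  assumes "convex A" "A \<noteq> {}" "convex B" "B \<noteq> {}"
  shows "dilate_volume A B (c * a) (c * b) = real c ^ CARD('n) * dilate_volume A B a b"
proof -
  define S where "S = (\<Sum>i<a. A) + (\<Sum>i<b. B)"
  have "convex S" "S \<noteq> {}"
    using assms sum_set_nonempty[of "{..<a}" "\<lambda>_. A"] sum_set_nonempty[of "{..<b}" "\<lambda>_. B"]
    by (auto simp: S_def intro!: convex_set_plus convex_set_sum)
  have "(\<Sum>i<c * a. A) + (\<Sum>i<c * b. B) = (\<Sum>j<c. S)"
    by (simp only: S_def sum_const_lessThan_mult sum.distrib)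
  also have "\<dots> = (\<lambda>x. real c *\<^sub>R x) ` S"
    by (rule sum_convex_set_eq_scaleR) fact+
  finally show ?thesis
    using measure_lebesgue_affine[of "real c" 0 S] by (simp add: dilate_volume_def S_def)
qed

lemma dilate_volume_brunn_minkowski:
  fixes A B :: "(real ^ 2) set"
  assumes "compact A" "convex A" "compact B" "convex B"
    and "dilate_volume A B a b > 0" "dilate_volume A B c d > 0"
  shows "sqrt (dilate_volume A B a b) + sqrt (dilate_volume A B c d) \<le> sqrt (dilate_volume A B (a + c) (b + d))"
proof -
  let ?S = "\<lambda>a b. (\<Sum>i<a. A) + (\<Sum>i<b. B)"
  have "compact (?S a b)" "convex (?S a b)" for a b :: nat
    using assms by (auto intro!: compact_set_plus convex_set_plus compact_sum_set convex_set_sum)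
  moreover have "?S (a + c) (b + d) = ?S a b + ?S c d"
    by (simp add: sum_const_lessThan_add ac_simps)
  ultimately show ?thesis
    using assms(5,6) brunn_minkowski_plane[of "?S a b" "?S c d"] by (simp add: dilate_volume_def)
qed

text \<open>
  By bilinearity of the mixed area \<open>V\<close>, the difference of the two sides is \<open>2 V(A, B)\<close>. The
  Brunn-Minkowski inequality suffices to see that it is positive: put \<open>P = 2 A + B\<close> and
  \<open>Q = A + 2 B\<close>. From \<open>P + Q = 3 (A + B)\<close> one gets a lower bound for the area of \<open>A + B\<close>, which is
  good enough if the areas of \<open>P\<close> and \<open>Q\<close> differ by a factor less than \<open>4\<close>; and they do, because
  \<open>2 P = Q + 3 A\<close> and \<open>2 Q = P + 3 B\<close>.
\<close>

lemma dilate_volume_mixed_area_pos: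
  fixes A B :: "(real ^ 2) set"
  assumes A: "compact A" "convex A" "measure lebesgue A > 0"
    and B: "compact B" "convex B" "measure lebesgue B > 0"
  shows "dilate_volume A B 2 1 + dilate_volume A B 1 2 < 5 * dilate_volume A B 1 1"
proof -
  define x y z where "x = sqrt (dilate_volume A B 2 1)" and "y = sqrt (dilate_volume A B 1 2)"
    and "z = sqrt (dilate_volume A B 1 1)"
  have ne: "A \<noteq> {}" "B \<noteq> {}" using A B by auto
  note scale = dilate_volume_scale[OF A(2) ne(1) B(2) ne(2)]
  note bm = dilate_volume_brunn_minkowski[OF A(1,2) B(1,2)]
  have "dilate_volume A B 1 0 = measure lebesgue A" "dilate_volume A B 0 1 = measure lebesgue B"
    by (simp_all add: dilate_volume_def del: set_zero flip: set_zero)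
  then have pos: "dilate_volume A B n 0 > 0" "dilate_volume A B 0 n > 0" if "n > 0" for n
    using scale[of n 1 0] scale[of n 0 1] A B that by simp_all
  have pos': "dilate_volume A B a b > 0" if "a > 0" "b > 0" for a b
  proof -
    have "0 < sqrt (dilate_volume A B a 0) + sqrt (dilate_volume A B 0 b)"
      using pos that by (intro add_pos_pos) auto
    also have "\<dots> \<le> sqrt (dilate_volume A B a b)"
      using bm[of a 0 0 b] pos that by simp
    finally show ?thesis by simp
  qed
  have "x + y \<le> sqrt (dilate_volume A B 3 3)"
    using bm[of 2 1 1 2] pos' by (simp add: x_def y_def eval_nat_numeral)
  then have "x + y \<le> 3 * z"
    using scale[of 3 1 1] by (simp add: z_def real_sqrt_mult)
  moreover have "y < 2 * x"
  proof -
    have "y < y + sqrt (dilate_volume A B 3 0)" using pos by simp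
    also have "\<dots> \<le> sqrt (dilate_volume A B 4 2)"
      using bm[of 1 2 3 0] pos pos' by (simp add: y_def)
    also have "\<dots> = 2 * x"
      using scale[of 2 2 1] by (simp add: x_def real_sqrt_mult)
    finally show ?thesis .
  qed
  moreover have "x < 2 * y"
  proof -
    have "x < x + sqrt (dilate_volume A B 0 3)" using pos by simp
    also have "\<dots> \<le> sqrt (dilate_volume A B 2 4)"
      using bm[of 2 1 0 3] pos pos' by (simp add: x_def)
    also have "\<dots> = 2 * y"
      using scale[of 2 1 2] by (simp add: y_def real_sqrt_mult)
    finally show ?thesis .
  qed
  moreover have "x > 0" "y > 0"
    using pos' by (simp_all add: x_def y_def)
  \<comment> \<open>The product equals \<open>5 x y - 2 x\<^sup>2 - 2 y\<^sup>2\<close>, and so does half of \<open>5 (x + y)\<^sup>2 - 9 (x\<^sup>2 + y\<^sup>2)\<close>.\<close>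
  ultimately have "(x + y)\<^sup>2 \<le> (3 * z)\<^sup>2" "0 < (2 * x - y) * (2 * y - x)"
    using power_mono[of "x + y" "3 * z" 2] by simp_all
  then have "x\<^sup>2 + y\<^sup>2 < 5 * z\<^sup>2"
    by (simp add: power2_eq_square algebra_simps)
  moreover have "x\<^sup>2 = dilate_volume A B 2 1" "y\<^sup>2 = dilate_volume A B 1 2" "z\<^sup>2 = dilate_volume A B 1 1"
    by (simp_all add: x_def y_def z_def dilate_volume_def)
  ultimately show ?thesis by simp
qed

section \<open>The volume as a functional on the convex-set algebra\<close>

definition minkowski_monom :: "(('n::finite) rat_convex \<Rightarrow>\<^sub>0 nat) \<Rightarrow> (real ^ 'n) set" where
  "minkowski_monom m = (\<Sum>K\<in>Poly_Mapping.keys m. \<Sum>i<Poly_Mapping.lookup m K. carrier_of K)"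

lemma minkowski_monom_superset:
  assumes "finite A" "Poly_Mapping.keys m \<subseteq> A"
  shows "minkowski_monom m = (\<Sum>K\<in>A. \<Sum>i<Poly_Mapping.lookup m K. carrier_of K)"
  unfolding minkowski_monom_def
  by (rule sum.mono_neutral_left) (use assms in \<open>auto simp: in_keys_iff\<close>)

lemma minkowski_monom_add: "minkowski_monom (m + m') = minkowski_monom m + minkowski_monom m'"
proof -
  let ?A = "Poly_Mapping.keys m \<union> Poly_Mapping.keys m'"
  have "minkowski_monom (m + m') = (\<Sum>K\<in>?A. \<Sum>i<Poly_Mapping.lookup (m + m') K. carrier_of K)"
    by (rule minkowski_monom_superset) (use Poly_Mapping.keys_add[of m m'] in auto)
  also have "\<dots> = minkowski_monom m + minkowski_monom m'"
    by (simp add: lookup_add sum_const_lessThan_add sum.distrib minkowski_monom_superset[of ?A m]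
        minkowski_monom_superset[of ?A m'])
  finally show ?thesis .
qed

lemma minkowski_monom_single: "minkowski_monom (Poly_Mapping.single K (Suc 0)) = carrier_of K"
  by (simp add: minkowski_monom_def)

lemma compact_carrier_of: "compact (carrier_of K)"
  and convex_carrier_of: "convex (carrier_of K)"
  using carrier_of_properties[of K] by auto

lemma compact_minkowski_monom: "compact (minkowski_monom m)"
  unfolding minkowski_monom_def by (intro compact_sum_set compact_carrier_of)

lemma convex_minkowski_monom: "convex (minkowski_monom m)"
  unfolding minkowski_monom_def by (intro convex_set_sum convex_carrier_of)

text \<open>
  The linear extension of the volume from monomials to the polynomial ring. It is not
  multiplicative, so it has to be checked that it vanishes on all multiples of the relations.
\<close>

definition free_volume :: "('n::finite) free_alg \<Rightarrow> real" where
  "free_volume p = (\<Sum>m\<in>Poly_Mapping.keys p.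
     of_rat (Poly_Mapping.lookup p m) * measure lebesgue (minkowski_monom m))"

lemma free_volume_superset:
  assumes "finite A" "Poly_Mapping.keys p \<subseteq> A"
  shows "free_volume p = (\<Sum>m\<in>A. of_rat (Poly_Mapping.lookup p m) * measure lebesgue (minkowski_monom m))"
  unfolding free_volume_def
  by (rule sum.mono_neutral_left) (use assms in \<open>auto simp: in_keys_iff\<close>)

lemma free_volume_add: "free_volume (p + q) = free_volume p + free_volume q"
proof -
  let ?A = "Poly_Mapping.keys p \<union> Poly_Mapping.keys q"
  have "free_volume (p + q) = (\<Sum>m\<in>?A. of_rat (Poly_Mapping.lookup (p + q) m) * measure lebesgue (minkowski_monom m))"
    by (rule free_volume_superset) (use Poly_Mapping.keys_add[of p q] in auto)
  also have "\<dots> = free_volume p + free_volume q"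
    by (simp add: lookup_add of_rat_add distrib_right sum.distrib free_volume_superset[of ?A p]
        free_volume_superset[of ?A q])
  finally show ?thesis .
qed

lemma free_volume_zero: "free_volume 0 = 0"
  by (simp add: free_volume_def)

lemma free_volume_diff: "free_volume (p - q) = free_volume p - free_volume q"
  using free_volume_add[of "p - q" q] by simp

lemma free_volume_single:
  "free_volume (Poly_Mapping.single m c) = of_rat c * measure lebesgue (minkowski_monom m)"
  by (simp add: free_volume_def)

lemma free_volume_scale: "free_volume (Poly_Mapping.single 0 c * p) = of_rat c * free_volume p"
  by (induction p rule: free_alg_induct)
    (simp_all add: free_volume_zero free_volume_add free_volume_single mult_single of_rat_mult distrib_left)

text \<open>
  If \<open>z = x + a = y + b\<close> with \<open>a \<in> A\<close> and \<open>b \<in> B\<close>, then the segment from \<open>a\<close> to \<open>b\<close> lies in \<open>A \<union> B\<close>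
  and by connectedness contains a point \<open>c\<close> of \<open>A \<inter> B\<close>. The same weights applied to \<open>x\<close> and \<open>y\<close>
  give a point of \<open>X\<close> that complements \<open>c\<close> to \<open>z\<close>.
\<close>

lemma set_plus_Int_convex:
  fixes A B X :: "'a::real_normed_vector set"
  assumes "closed A" "closed B" "convex (A \<union> B)" "convex X"
  shows "X + (A \<inter> B) = (X + A) \<inter> (X + B)"
proof
  show "(X + A) \<inter> (X + B) \<subseteq> X + (A \<inter> B)"
  proof
    fix z assume "z \<in> (X + A) \<inter> (X + B)"
    then have "z \<in> X + A" "z \<in> X + B" by auto
    then obtain x a y b where z: "z = x + a" "z = y + b" and xy: "x \<in> X" "y \<in> X" and ab: "a \<in> A" "b \<in> B"
      unfolding set_plus_def by blast
    have "closed_segment a b \<subseteq> A \<union> B"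
      using assms(3) ab by (intro closed_segment_subset) auto
    then have "A \<inter> B \<inter> closed_segment a b \<noteq> {}"
      using connected_closedD[OF connected_segment(1)[of a b], of A B] assms(1,2) ab by auto
    then obtain c where "c \<in> closed_segment a b" "c \<in> A \<inter> B" by auto
    then obtain u where u: "0 \<le> u" "u \<le> 1" and c: "c = (1 - u) *\<^sub>R a + u *\<^sub>R b"
      by (auto simp: in_segment)
    have "(1 - u) *\<^sub>R x + u *\<^sub>R y \<in> X"
      using assms(4) xy u by (intro convexD) auto
    moreover have "(1 - u) *\<^sub>R x + u *\<^sub>R y + c = (1 - u) *\<^sub>R (x + a) + u *\<^sub>R (y + b)"
      by (simp add: c algebra_simps)
    then have "(1 - u) *\<^sub>R x + u *\<^sub>R y + c = z"
      by (simp flip: z scaleR_add_left)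
    ultimately show "z \<in> X + (A \<inter> B)"
      using \<open>c \<in> A \<inter> B\<close> by (metis set_plus_intro)
  qed
qed (auto elim!: set_plus_elim)

lemma gen_product_single:
  "Poly_Mapping.single m c * gen K = Poly_Mapping.single (m + Poly_Mapping.single K 1) c"
  by (simp add: gen_def mult_single)

lemma free_volume_single_gen:
  "free_volume (Poly_Mapping.single m c * gen K) = of_rat c * measure lebesgue (minkowski_monom m + carrier_of K)"
  by (simp add: gen_product_single free_volume_single minkowski_monom_add minkowski_monom_single)

text \<open>
  A monomial factor amounts to adding a fixed compact convex set \<open>X\<close> to every set in the relation.
  Translation and sum relations are stable under this for formal reasons. For inclusion-exclusion,
  \<open>X + _\<close> commutes with unions, and with the intersection because the union is convex.
\<close>

lemma free_volume_single_relation: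
  assumes "p \<in> conv_relations"
  shows "free_volume (Poly_Mapping.single m c * p) = 0"
  using assms
proof (induction rule: conv_relations.induct)
  case (empty E)
  then show ?case by (simp add: free_volume_single_gen)
next
  case (inclusion_exclusion U K1 K2 I)
  let ?X = "minkowski_monom m"
  have fin: "?X + carrier_of K \<in> fmeasurable lebesgue" for K :: "'a rat_convex"
    by (intro lmeasurable_compact compact_set_plus compact_minkowski_monom compact_carrier_of)
  have "?X + carrier_of I = (?X + carrier_of K1) \<inter> (?X + carrier_of K2)"
    using inclusion_exclusion set_plus_Int_convex[of "carrier_of K1" "carrier_of K2" ?X]
      compact_imp_closed[OF compact_carrier_of] convex_carrier_of[of U] convex_minkowski_monom by metis
  moreover have "?X + carrier_of U = (?X + carrier_of K1) \<union> (?X + carrier_of K2)"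
    using inclusion_exclusion by (simp add: set_plus_Un)
  ultimately have "measure lebesgue (?X + carrier_of U) + measure lebesgue (?X + carrier_of I) =
      measure lebesgue (?X + carrier_of K1) + measure lebesgue (?X + carrier_of K2)"
    using measure_Un3[OF fin[of K1] fin[of K2]] by simp
  then show ?case
    by (simp add: distrib_left right_diff_distrib free_volume_add free_volume_diff free_volume_single_gen)
      (simp flip: distrib_left)
next
  case (translation t K' K)
  have "minkowski_monom m + carrier_of K' = (\<lambda>x. t + x) ` (minkowski_monom m + carrier_of K)"
    using translation(2) by (auto simp: set_plus_def image_iff) (metis add.assoc add.commute)+
  then show ?case
    by (simp add: right_diff_distrib free_volume_diff free_volume_single_gen measure_translation)
next
  case (minkowski_sum S K1 K2)
  have "carrier_of S = carrier_of K1 + carrier_of K2"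
    using minkowski_sum by (auto simp: set_plus_def)
  then show ?case
    by (simp add: right_diff_distrib free_volume_diff free_volume_single_gen gen_product_single free_volume_single
        minkowski_monom_add minkowski_monom_single add.assoc flip: mult.assoc)
next
  case (unit Z)
  then show ?case
    by (simp add: right_diff_distrib free_volume_diff free_volume_single_gen free_volume_single flip: set_zero)
qed

lemma free_volume_relation: "p \<in> conv_relations \<Longrightarrow> free_volume (r * p) = 0"
  by (induction r rule: free_alg_induct)
    (simp_all add: free_volume_zero free_volume_add free_volume_single_relation distrib_right)

lemma free_volume_ideal: "p \<in> conv_ideal \<Longrightarrow> free_volume p = 0"
  unfolding conv_ideal_def
  by (induction rule: ring_ideal.span_induct_alt)
    (simp_all add: free_volume_zero free_volume_add free_volume_relation)

lift_definition volume_functional :: "('n::finite) conv_alg \<Rightarrow> real" is free_volume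
  by (metis eq_iff_diff_eq_0 free_volume_ideal free_volume_diff)

lemma volume_functional_add: "volume_functional (x + y) = volume_functional x + volume_functional y"
  by transfer (rule free_volume_add)

lemma volume_functional_diff: "volume_functional (x - y) = volume_functional x - volume_functional y"
  by transfer (rule free_volume_diff)

lemma volume_functional_scale: "volume_functional (q *\<^sub>Q x) = of_rat q * volume_functional x"
  by transfer (rule free_volume_scale)

lemma volume_functional_numeral:
  "volume_functional (numeral n * x) = numeral n * volume_functional x"
proof -
  have "volume_functional (of_nat k * x) = of_nat k * volume_functional x" for k
  proof (induction k)
    case 0
    show ?case using volume_functional_diff[of 0 0] by simp
  qed (simp add: distrib_right volume_functional_add)
  from this[of "numeral n"] show ?thesis by simp
qed

section \<open>The degree of products of logarithms\<close>

lemma gen_power: "gen K ^ n = Poly_Mapping.single (Poly_Mapping.single K n) 1"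
  by (induction n) (simp_all add: gen_product_single mult.commute[of "gen K"] flip: single_add)

lemma conv_class_power: "conv_class K ^ n = abs_conv_alg (gen K ^ n)"
  by (induction n) (simp_all add: one_conv_alg.abs_eq times_conv_alg.abs_eq conv_class.abs_eq)

lemma volume_functional_power_times:
  "volume_functional (conv_class K ^ a * conv_class L ^ b) = dilate_volume (carrier_of K) (carrier_of L) a b"
proof -
  have "minkowski_monom (Poly_Mapping.single M n) = (\<Sum>i<n. carrier_of M)" for M :: "'a rat_convex" and n
    using minkowski_monom_superset[of "{M}" "Poly_Mapping.single M n"] by simp
  then show ?thesis
    by (simp add: conv_class_power times_conv_alg.abs_eq volume_functional.abs_eq gen_power mult_single
        free_volume_single minkowski_monom_add dilate_volume_def)
qed

lemma two_conv_log:
  fixes K :: "2 rat_convex"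
  shows "2 * conv_log K = 4 * conv_class K - conv_class K ^ 2 - 3"
proof -
  let ?x = "conv_class K - 1"
  let ?h = "(1 / 2) *\<^sub>Q ?x ^ 2"
  have log: "conv_log K = ?x - ?h"
    by (simp add: conv_log_def numeral_2_eq_2)
  have "2 * conv_log K = 2 * ?x - (?h + ?h)"
    unfolding log mult_2 by (simp only: add_diff_add)
  also have "?h + ?h = ?x ^ 2"
    by (simp flip: conv_alg.scale_left_distrib)
  finally have "2 * conv_log K = 2 * ?x - ?x ^ 2" .
  then show ?thesis by (simp add: power2_eq_square algebra_simps)
qed

text \<open>
  The product of the two quadratic polynomials from \<open>two_conv_log\<close>. All terms that involve only one of
  the sets cancel, since the area is homogeneous of degree two.
\<close>

lemma volume_functional_conv_log_times:
  fixes K L :: "2 rat_convex"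
  assumes K: "carrier_of K \<noteq> {}" and L: "carrier_of L \<noteq> {}"
  defines "V \<equiv> dilate_volume (carrier_of K) (carrier_of L)"
  shows "volume_functional (conv_log K * conv_log L) = 5 * V 1 1 - V 2 1 - V 1 2"
proof -
  define k l where "k = conv_class K" and "l = conv_class L"
  have V: "volume_functional (k ^ a * l ^ b) = V a b" for a b
    unfolding k_def l_def V_def by (rule volume_functional_power_times)
  have "4 * (conv_log K * conv_log L) = (2 * conv_log K) * (2 * conv_log L)"
    by simp
  also have "\<dots> = 16 * (k ^ 1 * l ^ 1) + 3 * (k ^ 2 * l ^ 0) + 3 * (k ^ 0 * l ^ 2) + k ^ 2 * l ^ 2 + 9 * (k ^ 0 * l ^ 0)
      - 4 * (k ^ 2 * l ^ 1) - 4 * (k ^ 1 * l ^ 2) - 12 * (k ^ 1 * l ^ 0) - 12 * (k ^ 0 * l ^ 1)"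
    unfolding two_conv_log k_def[symmetric] l_def[symmetric]
    by (simp add: algebra_simps)
  finally have "volume_functional (4 * (conv_log K * conv_log L)) =
      16 * V 1 1 + 3 * V 2 0 + 3 * V 0 2 + V 2 2 + 9 * V 0 0 - 4 * V 2 1 - 4 * V 1 2 - 12 * V 1 0 - 12 * V 0 1"
    by (simp only: volume_functional_add volume_functional_diff volume_functional_numeral V)
  moreover have "V (2 * a) (2 * b) = 4 * V a b" for a b
    unfolding V_def using dilate_volume_scale[OF convex_carrier_of K convex_carrier_of L, of 2 a b] by simp
  \<comment> \<open>\<open>V 0 0 = 0\<close> because \<open>V 0 0 = 4 * V 0 0\<close>.\<close>
  from this[of 0 0] this[of 1 0] this[of 0 1] this[of 1 1]
  have "V 0 0 = 0" "V 2 0 = 4 * V 1 0" "V 0 2 = 4 * V 0 1" "V 2 2 = 4 * V 1 1"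
    by simp_all
  ultimately show ?thesis
    by (simp add: volume_functional_numeral)
qed

lemma volume_functional_conv_log_square:
  fixes K :: "2 rat_convex"
  assumes K: "carrier_of K \<noteq> {}"
  shows "volume_functional (conv_log K ^ 2) = 2 * measure lebesgue (carrier_of K)"
proof -
  let ?V = "dilate_volume (carrier_of K) (carrier_of K)"
  have V: "?V a b = ?V (a + b) 0" for a b
    by (simp add: dilate_volume_def sum_const_lessThan_add)
  have scale: "?V n 0 = (real n)\<^sup>2 * ?V 1 0" for n
    using dilate_volume_scale[OF convex_carrier_of K convex_carrier_of K, of n 1 0] by simp
  have "?V 1 1 = 4 * ?V 1 0" "?V 2 1 = 9 * ?V 1 0" "?V 1 2 = 9 * ?V 1 0"
    using V[of 1 1] V[of 2 1] V[of 1 2] scale[of 2] scale[of 3] by (simp_all add: eval_nat_numeral)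
  moreover have "?V 1 0 = measure lebesgue (carrier_of K)"
    by (simp add: dilate_volume_def del: set_zero flip: set_zero)
  ultimately show ?thesis
    unfolding power2_eq_square[of "conv_log K"] volume_functional_conv_log_times[OF K K]
    by simp
qed

text \<open>
  Existence of the degree map comes from the volume functional, uniqueness from the fact that the
  squares of logarithms span the top piece.
\<close>

lemma conv_deg_eq_volume_functional:
  fixes x :: "2 conv_alg"
  shows "conv_deg x = (if x \<in> conv_graded 2 then Some (volume_functional x) else None)"
proof -
  define D where "D = (\<lambda>x :: 2 conv_alg. if x \<in> conv_graded 2 then Some (volume_functional x) else None)"
  have span: "x + y \<in> conv_graded 2" "q *\<^sub>Q x \<in> conv_graded 2"
    if "x \<in> conv_graded 2" "y \<in> conv_graded 2" for x y :: "2 conv_alg" and q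
    using that by (auto simp: conv_graded_def conv_alg.span_add conv_alg.span_scale)
  have "conv_log K ^ 2 \<in> conv_graded 2" if "carrier_of K \<noteq> {}" for K :: "2 rat_convex"
    using that by (auto simp: conv_graded_def intro!: conv_alg.span_base)
  then have "is_degree_map D"
    unfolding is_degree_map_def using span
    by (auto simp: D_def dom_def volume_functional_add volume_functional_scale
        volume_functional_conv_log_square split: if_splits)
  moreover have "d = D" if d: "is_degree_map d" for d
  proof
    fix x :: "2 conv_alg"
    have dom: "dom d = conv_graded 2"
      and add: "\<And>x y a b. d x = Some a \<Longrightarrow> d y = Some b \<Longrightarrow> d (x + y) = Some (a + b)"
      and scale: "\<And>q x a. d x = Some a \<Longrightarrow> d (q *\<^sub>Q x) = Some (of_rat q * a)"
      and log: "\<And>K. carrier_of K \<noteq> {} \<Longrightarrow> d (conv_log K ^ 2) = Some (2 * measure lebesgue (carrier_of K))"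
      using d unfolding is_degree_map_def by (simp_all add: fact_2)
    have "d x = Some (volume_functional x)" if "x \<in> conv_graded 2"
      using that unfolding conv_graded_def
    proof (induction rule: conv_alg.span_induct_alt)
      case base
      have "0 \<in> dom d"
        unfolding dom conv_graded_def by (rule conv_alg.span_zero)
      then obtain a where "d 0 = Some a" by auto
      from scale[OF this, of 0] show ?case
        using volume_functional_diff[of 0 0] by simp
    next
      case (step c x y)
      then obtain K where "carrier_of K \<noteq> {}" "x = conv_log K ^ 2" by blast
      then have "d x = Some (volume_functional x)"
        using log[of K] volume_functional_conv_log_square[of K] by simp
      from add[OF scale[OF this] step(2)] show ?case
        by (simp add: volume_functional_add volume_functional_scale)
    qed
    then show "d x = D x"
      using dom by (auto simp: D_def)
  qed
  ultimately have "conv_deg = D"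
    unfolding conv_deg_def by (rule the_equality)
  then have "conv_deg x = D x" by (rule fun_cong)
  then show ?thesis by (simp only: D_def)
qed

theorem corollary8p2:
  fixes K L :: "2 rat_convex" and k l :: "2 conv_alg" and d :: real
  assumes "carrier_of K \<noteq> {}"
    and "k = conv_log K"
    and "conv_deg (k ^ 2) = Some d" and "d > 0"
    and "carrier_of L \<noteq> {}"
    and "l = conv_log L"
    and "conv_deg (l * k) = Some 0"
  shows "conv_deg (l ^ 2) = Some 0"
proof -
  let ?V = "dilate_volume (carrier_of L) (carrier_of K)"
  have "5 * ?V 1 1 - ?V 2 1 - ?V 1 2 = 0"
    using assms volume_functional_conv_log_times[of L K]
    by (simp add: conv_deg_eq_volume_functional split: if_splits)
  moreover have "measure lebesgue (carrier_of K) > 0"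
    using assms volume_functional_conv_log_square[of K]
    by (simp add: conv_deg_eq_volume_functional split: if_splits)
  ultimately have "\<not> measure lebesgue (carrier_of L) > 0"
    using dilate_volume_mixed_area_pos[of "carrier_of L" "carrier_of K"]
    by (auto simp: compact_carrier_of convex_carrier_of)
  then have "measure lebesgue (carrier_of L) = 0"
    by (simp add: not_less measure_le_0_iff)
  then have "volume_functional (l ^ 2) = 0"
    using assms volume_functional_conv_log_square[of L] by simp
  moreover have "l ^ 2 \<in> conv_graded 2"
    using assms by (auto simp: conv_graded_def intro!: conv_alg.span_base)
  ultimately show ?thesis
    by (simp add: conv_deg_eq_volume_functional)
qed

end
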